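(* Let $X$ be a finite non-empty set and $R$ a monotone transit function on $X$ satisfying (uc): for all $x,y,u,v\in X$, if $R(x,y)\cap R(u,v)\neq\emptyset$ then there are $p,q\in R(x,y)\cup R(u,v)$ with $R(x,y)\cup R(u,v)=R(p,q)$. Then $R$ satisfies (w): for all $x,y,z\in X$, $z\in R(x,y)$ or $y\in R(x,z)$ or $x\in R(y,z)$; and (wp): for all $u,v,x,y,p,q\in X$, if $R(u,v)\cap R(x,y)$, $R(u,v)\cap R(p,q)$ and $R(x,y)\cap R(p,q)$ are all non-empty, then $R(p,q)\subseteq R(u,v)\cup R(x,y)$ or $R(u,v)\subseteq R(p,q)\cup R(x,y)$ or $R(x,y)\subseteq R(p,q)\cup R(u,v)$.
   Context: A transit function on a finite non-empty set $X$ is a map $R:X\times X\to 2^X$ such that for all $u,v\in X$: $u\in R(u,v)$, $R(u,v)=R(v,u)$, and $R(u,u)=\{u\}$. $R$ is monotone if for all $u,v,p,q\in X$, $p,q\in R(u,v)$ implies $R(p,q)\subseteq R(u,v)$. *)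

theory Defs
  imports Main
begin

text \<open>All notions are relative to a carrier set \<open>X\<close>; the values of \<open>R\<close> at
  arguments outside \<open>X\<close> are unconstrained and never used.\<close>

definition transit_function :: "'a set \<Rightarrow> ('a \<Rightarrow> 'a \<Rightarrow> 'a set) \<Rightarrow> bool" where
  "transit_function X R \<longleftrightarrow> finite X \<and> X \<noteq> {} \<and>
     (\<forall>u\<in>X. \<forall>v\<in>X. R u v \<subseteq> X \<and> u \<in> R u v \<and> R u v = R v u \<and> R u u = {u})"

definition monotone_transit :: "'a set \<Rightarrow> ('a \<Rightarrow> 'a \<Rightarrow> 'a set) \<Rightarrow> bool" where
  "monotone_transit X R \<longleftrightarrow>
     (\<forall>u\<in>X. \<forall>v\<in>X. \<forall>p\<in>X. \<forall>q\<in>X. p \<in> R u v \<and> q \<in> R u v \<longrightarrow> R p q \<subseteq> R u v)"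

definition axiom_uc :: "'a set \<Rightarrow> ('a \<Rightarrow> 'a \<Rightarrow> 'a set) \<Rightarrow> bool" where
  "axiom_uc X R \<longleftrightarrow>
     (\<forall>x\<in>X. \<forall>y\<in>X. \<forall>u\<in>X. \<forall>v\<in>X. R x y \<inter> R u v \<noteq> {} \<longrightarrow>
        (\<exists>p \<in> R x y \<union> R u v. \<exists>q \<in> R x y \<union> R u v. R x y \<union> R u v = R p q))"

definition axiom_w :: "'a set \<Rightarrow> ('a \<Rightarrow> 'a \<Rightarrow> 'a set) \<Rightarrow> bool" where
  "axiom_w X R \<longleftrightarrow>
     (\<forall>x\<in>X. \<forall>y\<in>X. \<forall>z\<in>X. z \<in> R x y \<or> y \<in> R x z \<or> x \<in> R y z)"

definition axiom_wp :: "'a set \<Rightarrow> ('a \<Rightarrow> 'a \<Rightarrow> 'a set) \<Rightarrow> bool" where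
  "axiom_wp X R \<longleftrightarrow>
     (\<forall>u\<in>X. \<forall>v\<in>X. \<forall>x\<in>X. \<forall>y\<in>X. \<forall>p\<in>X. \<forall>q\<in>X.
        R u v \<inter> R x y \<noteq> {} \<and> R u v \<inter> R p q \<noteq> {} \<and> R x y \<inter> R p q \<noteq> {} \<longrightarrow>
        R p q \<subseteq> R u v \<union> R x y \<or> R u v \<subseteq> R p q \<union> R x y \<or> R x y \<subseteq> R p q \<union> R u v)"

end

theory Submission
  imports Defs
begin

text \<open>Since the union of two intersecting transit sets is again a transit set, it is closed under
  \<open>R\<close>. For (wp), the union of all three sets is some \<open>R s t\<close>, and two of the three sets already
  contain both \<open>s\<close> and \<open>t\<close>, so their union contains the third. For (w), if \<open>x\<close>, \<open>y\<close>, \<open>z\<close> violated the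
  axiom, each of the sets \<open>R x y\<close>, \<open>R x z\<close>, \<open>R y z\<close> would lie in the union of the other two. Writing
  \<open>R x y \<union> R x z = R p q\<close>, neither of these two sets contains both \<open>p\<close> and \<open>q\<close>, which forces both
  points into \<open>R y z\<close> and hence \<open>x \<in> R p q \<subseteq> R y z\<close>.\<close>

locale union_closed_transit =
  fixes X :: "'a set" and R :: "'a \<Rightarrow> 'a \<Rightarrow> 'a set"
  assumes transit: "transit_function X R"
    and monotone: "monotone_transit X R"
    and union_closed: "axiom_uc X R"
begin

lemma subset_carrier: "u \<in> X \<Longrightarrow> v \<in> X \<Longrightarrow> R u v \<subseteq> X"
  and left_mem: "u \<in> X \<Longrightarrow> v \<in> X \<Longrightarrow> u \<in> R u v"
  and commute: "u \<in> X \<Longrightarrow> v \<in> X \<Longrightarrow> R u v = R v u"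
  using transit unfolding transit_function_def by blast+

lemma right_mem: "u \<in> X \<Longrightarrow> v \<in> X \<Longrightarrow> v \<in> R u v"
  using left_mem commute by blast

lemma convex:
  assumes "u \<in> X" "v \<in> X" "p \<in> R u v" "q \<in> R u v"
  shows "R p q \<subseteq> R u v"
  using assms monotone subset_carrier unfolding monotone_transit_def by blast

lemma union_eq:
  assumes "x \<in> X" "y \<in> X" "u \<in> X" "v \<in> X" "R x y \<inter> R u v \<noteq> {}"
  obtains p q where "p \<in> X" "q \<in> X" "p \<in> R x y \<union> R u v" "q \<in> R x y \<union> R u v"
    "R x y \<union> R u v = R p q"
proof -
  obtain p q where pq: "p \<in> R x y \<union> R u v" "q \<in> R x y \<union> R u v" "R x y \<union> R u v = R p q"
    using assms union_closed unfolding axiom_uc_def by meson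
  moreover have "p \<in> X" "q \<in> X"
    using pq(1,2) subset_carrier assms(1-4) by blast+
  ultimately show thesis
    using that by blast
qed

lemma union_convex:
  assumes "x \<in> X" "y \<in> X" "u \<in> X" "v \<in> X" "R x y \<inter> R u v \<noteq> {}"
    and "s \<in> R x y \<union> R u v" "t \<in> R x y \<union> R u v"
  shows "R s t \<subseteq> R x y \<union> R u v"
  by (rule union_eq[OF assms(1-5)]) (use assms(6,7) convex in simp)

lemma satisfies_w: "axiom_w X R"
  unfolding axiom_w_def
proof (intro ballI, rule ccontr)
  fix x y z
  assume X: "x \<in> X" "y \<in> X" "z \<in> X"
    and "\<not> (z \<in> R x y \<or> y \<in> R x z \<or> x \<in> R y z)"
  then have z: "z \<notin> R x y" and y: "y \<notin> R x z" and x: "x \<notin> R y z"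
    by auto
  note mem = X left_mem right_mem
  have "R x y \<inter> R x z \<noteq> {}" "R x z \<inter> R y z \<noteq> {}" "R x y \<inter> R y z \<noteq> {}"
    using mem by blast+
  \<comment> \<open>The endpoints of each left-hand set lie in different sets on the right, and
    those two share the remaining point: \<open>z\<close> for \<open>xy\<close>, \<open>y\<close>
    for \<open>xz\<close>.\<close>
  then have xy: "R x y \<subseteq> R x z \<union> R y z" and xz: "R x z \<subseteq> R x y \<union> R y z"
    using mem by (intro union_convex; blast)+
  obtain p q where pq: "p \<in> R x y \<union> R x z" "q \<in> R x y \<union> R x z" "R x y \<union> R x z = R p q"
    using union_eq[of x y x z] \<open>R x y \<inter> R x z \<noteq> {}\<close> X by metis
  \<comment> \<open>Otherwise monotonicity puts \<open>R p q\<close>, and with it \<open>z\<close>,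
    inside \<open>R x y\<close>.\<close>
  have "\<not> (p \<in> R x y \<and> q \<in> R x y)"
    using convex[of x y p q] pq(3) z mem by blast
  moreover have "\<not> (p \<in> R x z \<and> q \<in> R x z)"
    using convex[of x z p q] pq(3) y mem by blast
  \<comment> \<open>One of \<open>p\<close>, \<open>q\<close> lies only in \<open>R x y\<close> and
    the other only in \<open>R x z\<close>; \<open>xy\<close> and \<open>xz\<close> then push each
    into \<open>R y z\<close>.\<close>
  ultimately have "p \<in> R y z" "q \<in> R y z"
    using pq(1,2) xy xz by blast+
  then have "R p q \<subseteq> R y z"
    using convex X by blast
  then show False
    using pq(3) x mem by blast
qed

lemma satisfies_wp: "axiom_wp X R"
  unfolding axiom_wp_def
proof (intro ballI impI, elim conjE)
  fix u v x y p q
  assume X: "u \<in> X" "v \<in> X" "x \<in> X" "y \<in> X" "p \<in> X" "q \<in> X"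
    and ux: "R u v \<inter> R x y \<noteq> {}" and up: "R u v \<inter> R p q \<noteq> {}" and xp: "R x y \<inter> R p q \<noteq> {}"
  obtain a b where ab: "a \<in> X" "b \<in> X" "R u v \<union> R x y = R a b"
    using union_eq[of u v x y] X ux by metis
  have "R a b \<inter> R p q \<noteq> {}"
    using up ab(3) by blast
  then obtain s t where st: "s \<in> R a b \<union> R p q" "t \<in> R a b \<union> R p q" "R a b \<union> R p q = R s t"
    using union_eq[of a b p q] ab X by metis
  \<comment> \<open>Pick one of the three sets for \<open>s\<close> and one for \<open>t\<close>: at
    most two are used, so some pair covers both points.\<close>
  consider "s \<in> R u v \<union> R x y" "t \<in> R u v \<union> R x y"
    | "s \<in> R u v \<union> R p q" "t \<in> R u v \<union> R p q"
    | "s \<in> R x y \<union> R p q" "t \<in> R x y \<union> R p q"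
    using st(1,2) ab(3) by blast
  then show "R p q \<subseteq> R u v \<union> R x y \<or> R u v \<subseteq> R p q \<union> R x y \<or> R x y \<subseteq> R p q \<union> R u v"
  proof cases
    case 1
    then have "R s t \<subseteq> R u v \<union> R x y" using union_convex X ux by simp
    then show ?thesis using st(3) by blast
  next
    case 2
    then have "R s t \<subseteq> R u v \<union> R p q" using union_convex X up by simp
    then show ?thesis using st(3) ab(3) by blast
  next
    case 3
    then have "R s t \<subseteq> R x y \<union> R p q" using union_convex X xp by simp
    then show ?thesis using st(3) ab(3) by blast
  qed
qed

end

theorem theorem4:
  fixes X :: "'a set" and R :: "'a \<Rightarrow> 'a \<Rightarrow> 'a set"
  assumes "transit_function X R"
    and "monotone_transit X R"
    and "axiom_uc X R"
  shows "axiom_w X R \<and> axiom_wp X R"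
proof -
  interpret union_closed_transit X R
    using assms by unfold_locales
  show ?thesis
    using satisfies_w satisfies_wp by blast
qed

end
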